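(* Let $c\in C^2([0,H])$ with $0<c_m=\min c<c_M=\max c$, let $\varepsilon>0$ and $\Lambda>\varepsilon$, and let $$\mathscr{A}^c_{\varepsilon,\Lambda}=\mathscr{A}^c_\varepsilon\cap\{\lambda\le(c_M+\Lambda)\mu_k^2\}.$$ For $(\mu_k,\lambda)\in\mathscr{A}^c_{\varepsilon,\Lambda}$ let $u(y;\lambda,k)$ be a solution, normalized in $L^2(0,H)$, of $$(c(y)u')'+(\lambda-c(y)\mu_k^2)u=0\ \text{ on }(0,H),\qquad u(0)=u(H)=0.$$ Then for every nonempty interval $(a,b)\subseteq(0,H)$, $$\inf_{(\mu_k,\lambda)\in\mathscr{A}^c_{\varepsilon,\Lambda}}\int_a^b u(y;\lambda,k)^2\,dy>0.$$
   Context: $\Omega'\subset\mathbb{R}^d$ ($d\ge1$) is a fixed bounded smooth open domain and $H>0$ is fixed. $\mu_1^2\le\mu_2^2\le\cdots$ (with $\mu_k>0$) are the eigenvalues, counted with multiplicity, of the Dirichlet Laplacian in $L^2(\Omega')$. For $k\ge1$, $$A_k=c(y)\mu_k^2-\frac{d}{dy}c(y)\frac{d}{dy}\ \text{ in }L^2(0,H),\qquad D(A_k)=\{u\in H^1_0(0,H):\ cu'\in H^1(0,H)\},$$ is self-adjoint with simple eigenvalues $\beta_{k,1}<\beta_{k,2}<\cdots$. $\mathscr{A}^c_\varepsilon=\bigcup_{k\ge1}\{(\mu_k,\lambda):\ \lambda=\beta_{k,\ell}\text{ for some }\ell\ge1,\ \lambda\ge(c_M+\varepsilon)\mu_k^2\}$.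 Solutions $u$ are real-valued. *)

theory Defs
  imports "HOL-Analysis.Analysis"
begin

section \<open>Smooth functions and smooth domains\<close>

fun Ck_on :: "nat \<Rightarrow> 'a::euclidean_space set \<Rightarrow> ('a \<Rightarrow> real) \<Rightarrow> bool" where
  "Ck_on 0 S f \<longleftrightarrow> continuous_on S f"
| "Ck_on (Suc n) S f \<longleftrightarrow>
     (\<forall>x\<in>S. f differentiable (at x)) \<and>
     (\<forall>i\<in>Basis. Ck_on n S (\<lambda>x. frechet_derivative f (at x) i))"

text \<open>Only meant for open \<open>S\<close>, since the derivatives are taken at full neighbourhoods.\<close>

definition smooth_on :: "'a::euclidean_space set \<Rightarrow> ('a \<Rightarrow> real) \<Rightarrow> bool" where
  "smooth_on S f \<longleftrightarrow> (\<forall>n. Ck_on n S f)"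

definition grad :: "('a::euclidean_space \<Rightarrow> real) \<Rightarrow> 'a \<Rightarrow> 'a" where
  "grad f x = (\<Sum>i\<in>Basis. frechet_derivative f (at x) i *\<^sub>R i)"

text \<open>The boundary is smooth in the sense of local defining functions: near each boundary
  point, \<open>\<Omega>\<close> is a sublevel set of a smooth function with non-vanishing gradient.\<close>

definition bounded_smooth_domain :: "'a::euclidean_space set \<Rightarrow> bool" where
  "bounded_smooth_domain \<Omega> \<longleftrightarrow>
     open \<Omega> \<and> connected \<Omega> \<and> \<Omega> \<noteq> {} \<and> bounded \<Omega> \<and>
     (\<forall>p\<in>frontier \<Omega>. \<exists>U \<rho>. open U \<and> p \<in> U \<and> smooth_on U \<rho> \<and>
        (\<forall>x\<in>U. grad \<rho> x \<noteq> 0) \<and> \<Omega> \<inter> U = {x\<in>U. \<rho> x < 0})"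

text \<open>\<open>f\<close> belongs to \<open>C\<^sup>2([a,b])\<close>; derivatives at the end points are one-sided.\<close>

definition C2_on_Icc :: "real \<Rightarrow> real \<Rightarrow> (real \<Rightarrow> real) \<Rightarrow> bool" where
  "C2_on_Icc a b f \<longleftrightarrow>
     (\<exists>f' f''. (\<forall>y\<in>{a..b}. (f has_real_derivative f' y) (at y within {a..b})) \<and>
               (\<forall>y\<in>{a..b}. (f' has_real_derivative f'' y) (at y within {a..b})) \<and>
               continuous_on {a..b} f'')"

section \<open>Sobolev spaces\<close>

text \<open>Elements of \<open>L\<^sup>2\<close>, \<open>H\<^sup>1\<close>, \<open>H\<^sup>1\<^sub>0\<close> are represented by functions, not by classes modulo
  equality almost everywhere; the predicates below are invariant under changes on null sets.\<close>

definition L2 :: "'a::euclidean_space set \<Rightarrow> ('a \<Rightarrow> 'b::euclidean_space) set" where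
  "L2 \<Omega> = {f. f \<in> borel_measurable (lebesgue_on \<Omega>) \<and>
              integrable (lebesgue_on \<Omega>) (\<lambda>x. (norm (f x))\<^sup>2)}"

definition test_functions :: "'a::euclidean_space set \<Rightarrow> ('a \<Rightarrow> real) set" where
  "test_functions \<Omega> = {\<phi>. smooth_on UNIV \<phi> \<and> compact (closure {x. \<phi> x \<noteq> 0}) \<and>
                           closure {x. \<phi> x \<noteq> 0} \<subseteq> \<Omega>}"

text \<open>For \<open>'a = real\<close> the weak gradient is the weak derivative.\<close>

definition has_weak_grad ::
    "'a::euclidean_space set \<Rightarrow> ('a \<Rightarrow> real) \<Rightarrow> ('a \<Rightarrow> 'a) \<Rightarrow> bool" where
  "has_weak_grad \<Omega> u G \<longleftrightarrow> u \<in> L2 \<Omega> \<and> G \<in> L2 \<Omega> \<and>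
     (\<forall>\<phi>\<in>test_functions \<Omega>.
        (LINT x|lebesgue_on \<Omega>. u x *\<^sub>R grad \<phi> x) = - (LINT x|lebesgue_on \<Omega>. \<phi> x *\<^sub>R G x))"

text \<open>\<open>H\<^sup>1\<^sub>0\<close> is the closure of the test functions in the \<open>H\<^sup>1\<close> norm.\<close>

definition H10 :: "'a::euclidean_space set \<Rightarrow> ('a \<Rightarrow> real) set" where
  "H10 \<Omega> = {u. \<exists>G. has_weak_grad \<Omega> u G \<and>
     (\<exists>\<phi>::nat \<Rightarrow> 'a \<Rightarrow> real. (\<forall>n. \<phi> n \<in> test_functions \<Omega>) \<and>
        (\<lambda>n. LINT x|lebesgue_on \<Omega>. (u x - \<phi> n x)\<^sup>2) \<longlonglongrightarrow> 0 \<and>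
        (\<lambda>n. LINT x|lebesgue_on \<Omega>. (norm (G x - grad (\<phi> n) x))\<^sup>2) \<longlonglongrightarrow> 0)}"

section \<open>The Dirichlet Laplacian\<close>

text \<open>Graph of \<open>-\<Delta>\<close> in \<open>L\<^sup>2(\<Omega>)\<close> with domain \<open>{u \<in> H\<^sup>1\<^sub>0. \<Delta>u \<in> L\<^sup>2}\<close>, where \<open>\<Delta>u\<close> is
  understood in the sense of distributions.\<close>

definition dirichlet_laplacian ::
    "'a::euclidean_space set \<Rightarrow> ('a \<Rightarrow> real) \<Rightarrow> ('a \<Rightarrow> real) \<Rightarrow> bool" where
  "dirichlet_laplacian \<Omega> u f \<longleftrightarrow> u \<in> H10 \<Omega> \<and> f \<in> L2 \<Omega> \<and>
     (\<exists>G. has_weak_grad \<Omega> u G \<and>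
        (\<forall>\<phi>\<in>test_functions \<Omega>.
           (LINT x|lebesgue_on \<Omega>. G x \<bullet> grad \<phi> x) = (LINT x|lebesgue_on \<Omega>. f x * \<phi> x)))"

definition dirichlet_eigenspace :: "'a::euclidean_space set \<Rightarrow> real \<Rightarrow> ('a \<Rightarrow> real) set" where
  "dirichlet_eigenspace \<Omega> s = {u. dirichlet_laplacian \<Omega> u (\<lambda>x. s * u x)}"

text \<open>Dimension of a space of functions modulo equality almost everywhere: there is a basis
  of length \<open>n\<close>.\<close>

definition has_ae_dim :: "'a measure \<Rightarrow> ('a \<Rightarrow> real) set \<Rightarrow> nat \<Rightarrow> bool" where
  "has_ae_dim M E n \<longleftrightarrow>
     (\<exists>\<phi>::nat \<Rightarrow> 'a \<Rightarrow> real. (\<forall>i<n. \<phi> i \<in> E) \<and>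
        (\<forall>a::nat \<Rightarrow> real. (AE x in M. (\<Sum>i<n. a i * \<phi> i x) = 0) \<longrightarrow> (\<forall>i<n. a i = 0)) \<and>
        (\<forall>u\<in>E. \<exists>a::nat \<Rightarrow> real. AE x in M. u x = (\<Sum>i<n. a i * \<phi> i x)))"

text \<open>\<open>\<mu>\<^sub>1\<^sup>2 \<le> \<mu>\<^sub>2\<^sup>2 \<le> \<dots>\<close>, with \<open>\<mu>\<^sub>k > 0\<close>, lists the eigenvalues of the Dirichlet Laplacian, each
  \<open>s\<close> being repeated according to the dimension of its eigenspace (which is 0 if \<open>s\<close> is not
  an eigenvalue). Sequences are indexed from 1; the value at 0 is irrelevant.\<close>

definition dirichlet_frequencies :: "'a::euclidean_space set \<Rightarrow> (nat \<Rightarrow> real) \<Rightarrow> bool" where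
  "dirichlet_frequencies \<Omega> \<mu> \<longleftrightarrow>
     (\<forall>k\<ge>1. 0 < \<mu> k) \<and>
     (\<forall>k\<ge>1. \<forall>l\<ge>k. (\<mu> k)\<^sup>2 \<le> (\<mu> l)\<^sup>2) \<and>
     (\<forall>s. finite {k. k \<ge> 1 \<and> (\<mu> k)\<^sup>2 = s} \<and>
          has_ae_dim (lebesgue_on \<Omega>) (dirichlet_eigenspace \<Omega> s)
            (card {k. k \<ge> 1 \<and> (\<mu> k)\<^sup>2 = s}))"

section \<open>The one-dimensional operators\<close>

text \<open>Graph of \<open>A = c m\<^sup>2 - d/dy c d/dy\<close> in \<open>L\<^sup>2(0,H)\<close> with domain
  \<open>{u \<in> H\<^sup>1\<^sub>0(0,H). c u' \<in> H\<^sup>1(0,H)}\<close>; \<open>v\<close> is \<open>u'\<close> and \<open>w\<close> is \<open>(c u')'\<close>.\<close>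

definition SL_operator ::
    "real \<Rightarrow> (real \<Rightarrow> real) \<Rightarrow> real \<Rightarrow> (real \<Rightarrow> real) \<Rightarrow> (real \<Rightarrow> real) \<Rightarrow> bool" where
  "SL_operator H c m u f \<longleftrightarrow> u \<in> H10 {0<..<H} \<and>
     (\<exists>v w. has_weak_grad {0<..<H} u v \<and>
            has_weak_grad {0<..<H} (\<lambda>y. c y * v y) w \<and>
            (AE y in lebesgue_on {0<..<H}. f y = c y * m\<^sup>2 * u y - w y))"

definition SL_eigenvalues :: "real \<Rightarrow> (real \<Rightarrow> real) \<Rightarrow> real \<Rightarrow> real set" where
  "SL_eigenvalues H c m =
     {t. \<exists>u. SL_operator H c m u (\<lambda>y. t * u y) \<and>
             \<not> (AE y in lebesgue_on {0<..<H}. u y = 0)}"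

definition SL_enumeration ::
    "real \<Rightarrow> (real \<Rightarrow> real) \<Rightarrow> (nat \<Rightarrow> real) \<Rightarrow> (nat \<Rightarrow> nat \<Rightarrow> real) \<Rightarrow> bool" where
  "SL_enumeration H c \<mu> \<beta> \<longleftrightarrow>
     (\<forall>k\<ge>1. strict_mono_on {1..} (\<beta> k) \<and> \<beta> k ` {1..} = SL_eigenvalues H c (\<mu> k))"

text \<open>Minimum and maximum of \<open>c\<close> over \<open>[0,H]\<close>; they are attained since \<open>c\<close> is continuous.\<close>

definition c_min :: "real \<Rightarrow> (real \<Rightarrow> real) \<Rightarrow> real" where
  "c_min H c = (INF y\<in>{0..H}. c y)"

definition c_max :: "real \<Rightarrow> (real \<Rightarrow> real) \<Rightarrow> real" where
  "c_max H c = (SUP y\<in>{0..H}. c y)"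

definition freq_set ::
    "real \<Rightarrow> (real \<Rightarrow> real) \<Rightarrow> (nat \<Rightarrow> real) \<Rightarrow> (nat \<Rightarrow> nat \<Rightarrow> real) \<Rightarrow> real \<Rightarrow> (real \<times> real) set" where
  "freq_set H c \<mu> \<beta> \<epsilon> =
     (\<Union>k\<in>{1..}. {(\<mu> k, t) |t. (\<exists>l\<ge>1. t = \<beta> k l) \<and> (c_max H c + \<epsilon>) * (\<mu> k)\<^sup>2 \<le> t})"

definition freq_set_trunc ::
    "real \<Rightarrow> (real \<Rightarrow> real) \<Rightarrow> (nat \<Rightarrow> real) \<Rightarrow> (nat \<Rightarrow> nat \<Rightarrow> real) \<Rightarrow> real \<Rightarrow> real \<Rightarrow>
     (real \<times> real) set" where
  "freq_set_trunc H c \<mu> \<beta> \<epsilon> \<Lambda> =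
     freq_set H c \<mu> \<beta> \<epsilon> \<inter> {(m, t). t \<le> (c_max H c + \<Lambda>) * m\<^sup>2}"

text \<open>Classical solutions of \<open>(c u')' + (t - c m\<^sup>2) u = 0\<close> on \<open>(0,H)\<close>, \<open>u(0) = u(H) = 0\<close>,
  continuous up to the boundary, with unit norm in \<open>L\<^sup>2(0,H)\<close>. As \<open>c\<close> is regular and
  positive, every weak solution agrees almost everywhere with a classical one.\<close>

definition normalized_solution ::
    "real \<Rightarrow> (real \<Rightarrow> real) \<Rightarrow> real \<Rightarrow> real \<Rightarrow> (real \<Rightarrow> real) \<Rightarrow> bool" where
  "normalized_solution H c m t u \<longleftrightarrow>
     continuous_on {0..H} u \<and> u 0 = 0 \<and> u H = 0 \<and>
     (\<exists>v w. \<forall>y\<in>{0<..<H}.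
        (u has_real_derivative v y) (at y) \<and>
        ((\<lambda>z. c z * v z) has_real_derivative w y) (at y) \<and>
        w y + (t - c y * m\<^sup>2) * u y = 0) \<and>
     (LINT y:{0<..<H}|lborel. (u y)\<^sup>2) = 1"

end

theory Submission
  imports Defs
begin

text \<open>
  Put \<open>p = c u'\<close> and \<open>q = t - c m\<^sup>2\<close>, so that the equation becomes the first-order system
  \<open>u' = p / c\<close>, \<open>p' = - q u\<close>. The frequency window says exactly that \<open>q\<close> is comparable to
  \<open>m\<^sup>2\<close>, uniformly: \<open>\<epsilon> m\<^sup>2 \<le> q \<le> (c\<^sub>M + \<Lambda>) m\<^sup>2\<close>. Every mode therefore oscillates on the whole of
  \<open>(0,H)\<close>, and no part of the interval is classically forbidden.

  The proof makes this quantitative in two steps, without asymptotics in \<open>m\<close>.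

  The first step shows that energy cannot concentrate. The energy \<open>E = p\<^sup>2 + c q u\<^sup>2\<close> satisfies
  \<open>E' = (c q)' u\<^sup>2\<close>: the terms in \<open>u p\<close> cancel. Since \<open>(c q)'\<close> is at most of order \<open>m\<^sup>2\<close> while
  \<open>E\<close> controls \<open>m\<^sup>2 u\<^sup>2\<close>, one gets \<open>\<bar>E'\<bar> \<le> K E\<close> with \<open>K\<close> independent of the mode, and Gronwall's
  argument makes the values of \<open>E\<close> at any two points comparable. As \<open>u\<close> has unit norm, \<open>E\<close> is at
  least a constant times \<open>m\<^sup>2\<close> at every point (\<open>energy_lower_bound\<close>).

  The second step converts local energy into local mass. The energy on a subinterval might
  a priori sit in \<open>p\<^sup>2\<close> alone. Testing the equation against \<open>\<psi>\<^sup>2 u\<close>, with a cutoff \<open>\<psi>\<close> that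
  vanishes at the ends of the subinterval, bounds the integral of \<open>\<psi>\<^sup>2 p\<^sup>2 / c\<close> by the integral of
  \<open>(m\<^sup>2 + 1) u\<^sup>2\<close> up to a constant (\<open>localized_virial_identity\<close>); this is the equipartition of
  kinetic and potential energy. Since \<open>m\<close> is bounded below by \<open>\<mu>\<^sub>1 > 0\<close>, the factor \<open>m\<^sup>2\<close> cancels
  and a bound uniform in the mode remains (\<open>local_mass_lower_bound\<close>).
\<close>

section \<open>Functions that control their derivative\<close>

text \<open>Gronwall's argument run in both directions: \<open>f(z) e\<^sup>K\<^sup>z\<close> is nondecreasing and
  \<open>f(z) e\<^sup>-\<^sup>K\<^sup>z\<close> is nonincreasing.\<close>

lemma exponential_comparison:
  fixes f f' :: "real \<Rightarrow> real"
  assumes deriv: "\<And>z. z \<in> {l<..<r} \<Longrightarrow> (f has_real_derivative f' z) (at z)"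
    and bound: "\<And>z. z \<in> {l<..<r} \<Longrightarrow> \<bar>f' z\<bar> \<le> K * f z"
    and x: "x \<in> {l<..<r}" and y: "y \<in> {l<..<r}"
  shows "f y \<le> exp (K * \<bar>y - x\<bar>) * f x"
proof (cases "x \<le> y")
  case True
  have "f y * exp (- K * y) \<le> f x * exp (- K * x)"
  proof (rule DERIV_nonpos_imp_nonincreasing[OF True])
    fix z assume "x \<le> z" "z \<le> y"
    then have z: "z \<in> {l<..<r}" using x y by auto
    have "((\<lambda>z. f z * exp (- K * z)) has_real_derivative (f' z - K * f z) * exp (- K * z)) (at z)"
      by (auto intro!: derivative_eq_intros deriv[OF z] simp: algebra_simps)
    moreover have "(f' z - K * f z) * exp (- K * z) \<le> 0"
      using bound[OF z] by (intro mult_nonpos_nonneg) auto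
    ultimately show "\<exists>d. ((\<lambda>z. f z * exp (- K * z)) has_real_derivative d) (at z) \<and> d \<le> 0"
      by blast
  qed
  then have "f y * exp (- K * y) * exp (K * y) \<le> f x * exp (- K * x) * exp (K * y)"
    by (intro mult_right_mono) auto
  then show ?thesis
    using True by (simp add: mult.assoc mult_exp_exp algebra_simps)
next
  case False
  then have le: "y \<le> x" by simp
  have "f y * exp (K * y) \<le> f x * exp (K * x)"
  proof (rule DERIV_nonneg_imp_nondecreasing[OF le])
    fix z assume "y \<le> z" "z \<le> x"
    then have z: "z \<in> {l<..<r}" using x y by auto
    have "((\<lambda>z. f z * exp (K * z)) has_real_derivative (f' z + K * f z) * exp (K * z)) (at z)"
      by (auto intro!: derivative_eq_intros deriv[OF z] simp: algebra_simps)
    moreover have "0 \<le> (f' z + K * f z) * exp (K * z)"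
      using bound[OF z] by (intro mult_nonneg_nonneg) auto
    ultimately show "\<exists>d. ((\<lambda>z. f z * exp (K * z)) has_real_derivative d) (at z) \<and> 0 \<le> d"
      by blast
  qed
  then have "f y * exp (K * y) * exp (- K * y) \<le> f x * exp (K * x) * exp (- K * y)"
    by (intro mult_right_mono) auto
  then show ?thesis
    using le by (simp add: mult.assoc mult_exp_exp algebra_simps)
qed

section \<open>Modes in a uniformly oscillatory frequency window\<close>

text \<open>Only \<open>H\<close>, a lower bound for \<open>m\<close> and the constants \<open>lo\<close>, \<open>hi\<close>, \<open>D\<close>, \<open>\<epsilon>\<close>, \<open>Q\<close> may enter the final estimate; the mode itself is
  given by \<open>m\<close>, \<open>t\<close>, \<open>u\<close> and the flux \<open>p = c u'\<close>.\<close>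

locale oscillatory_mode =
  fixes H lo hi D \<epsilon> Q m t :: real and c c' u p :: "real \<Rightarrow> real"
  assumes H_pos: "0 < H" and lo_pos: "0 < lo" and \<epsilon>_pos: "0 < \<epsilon>" and m_pos: "0 < m"
    and hi_le_Q: "hi \<le> Q"
    and c_deriv: "\<And>y. y \<in> {0<..<H} \<Longrightarrow> (c has_real_derivative c' y) (at y)"
    and c_lower: "\<And>y. y \<in> {0<..<H} \<Longrightarrow> lo \<le> c y"
    and c_upper: "\<And>y. y \<in> {0<..<H} \<Longrightarrow> c y \<le> hi"
    and c'_bound: "\<And>y. y \<in> {0<..<H} \<Longrightarrow> \<bar>c' y\<bar> \<le> D"
    and q_lower: "\<And>y. y \<in> {0<..<H} \<Longrightarrow> \<epsilon> * m\<^sup>2 \<le> t - c y * m\<^sup>2"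
    and q_upper: "\<And>y. y \<in> {0<..<H} \<Longrightarrow> t - c y * m\<^sup>2 \<le> Q * m\<^sup>2"
    and u_deriv: "\<And>y. y \<in> {0<..<H} \<Longrightarrow> (u has_real_derivative p y / c y) (at y)"
    and p_deriv: "\<And>y. y \<in> {0<..<H} \<Longrightarrow>
                    (p has_real_derivative - (t - c y * m\<^sup>2) * u y) (at y)"
    and u_cont: "continuous_on {0..H} u"
    and u_norm: "(LINT y:{0<..<H}|lborel. (u y)\<^sup>2) = 1"
begin

definition energy :: "real \<Rightarrow> real" where
  "energy y = (p y)\<^sup>2 + c y * (t - c y * m\<^sup>2) * (u y)\<^sup>2"

text \<open>The Gronwall constant: \<open>D Q m\<^sup>2\<close> bounds \<open>\<bar>(c q)'\<bar>\<close>, and \<open>lo \<epsilon> m\<^sup>2\<close> is a lower bound for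
  \<open>c q\<close>; the powers of \<open>m\<close> cancel.\<close>

definition energy_rate :: real where
  "energy_rate = D * Q / (lo * \<epsilon>)"

definition energy_floor :: real where
  "energy_floor = lo * \<epsilon> / (H * exp (energy_rate * H))"

lemma c_pos: "y \<in> {0<..<H} \<Longrightarrow> 0 < c y"
  using c_lower[of y] lo_pos by linarith

lemma hi_pos: "0 < hi"
  using c_pos[of "H/2"] c_upper[of "H/2"] H_pos by simp

lemma D_nonneg: "0 \<le> D"
  using c'_bound[of "H/2"] H_pos by simp

lemma energy_rate_nonneg: "0 \<le> energy_rate"
  unfolding energy_rate_def
  using D_nonneg hi_pos hi_le_Q lo_pos \<epsilon>_pos by simp

lemma energy_floor_pos: "0 < energy_floor"
  unfolding energy_floor_def using H_pos lo_pos \<epsilon>_pos by simp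

lemma energy_ge_mass:
  assumes y: "y \<in> {0<..<H}"
  shows "lo * \<epsilon> * m\<^sup>2 * (u y)\<^sup>2 \<le> energy y"
proof -
  have "lo * (\<epsilon> * m\<^sup>2) \<le> c y * (t - c y * m\<^sup>2)"
    using c_lower[OF y] q_lower[OF y] lo_pos \<epsilon>_pos c_pos[OF y] by (intro mult_mono) auto
  then have "lo * (\<epsilon> * m\<^sup>2) * (u y)\<^sup>2 \<le> c y * (t - c y * m\<^sup>2) * (u y)\<^sup>2"
    by (intro mult_right_mono) auto
  then show ?thesis
    unfolding energy_def by (simp add: mult.assoc add_increasing)
qed

lemma energy_nonneg: "y \<in> {0<..<H} \<Longrightarrow> 0 \<le> energy y"
  by (rule order_trans[OF _ energy_ge_mass]) (use lo_pos \<epsilon>_pos in auto)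

text \<open>The weight \<open>c q\<close> in front of \<open>u\<^sup>2\<close> is the one for which the contributions of \<open>u'\<close> and
  \<open>p'\<close> cancel.\<close>

lemma energy_deriv:
  assumes y: "y \<in> {0<..<H}"
  shows "(energy has_real_derivative c' y * (t - 2 * c y * m\<^sup>2) * (u y)\<^sup>2) (at y)"
proof -
  have "c y \<noteq> 0" using c_pos[OF y] by simp
  then show ?thesis
    unfolding energy_def[abs_def]
    by (auto intro!: derivative_eq_intros c_deriv[OF y] u_deriv[OF y] p_deriv[OF y]
        simp: field_simps power2_eq_square)
qed

lemma energy_deriv_bound:
  assumes y: "y \<in> {0<..<H}"
  shows "\<bar>c' y * (t - 2 * c y * m\<^sup>2) * (u y)\<^sup>2\<bar> \<le> energy_rate * energy y"
proof -
  have c: "0 \<le> c y * m\<^sup>2" "c y * m\<^sup>2 \<le> Q * m\<^sup>2"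
    using c_pos[OF y] c_upper[OF y] hi_le_Q by (auto intro!: mult_right_mono)
  have q: "0 \<le> t - c y * m\<^sup>2"
    using q_lower[OF y] \<epsilon>_pos by (meson less_imp_le mult_nonneg_nonneg order_trans zero_le_power2)
  \<comment> \<open>a difference of two numbers of \<open>[0, Q m\<^sup>2]\<close>\<close>
  have "\<bar>t - 2 * c y * m\<^sup>2\<bar> \<le> Q * m\<^sup>2"
    using c q q_upper[OF y] by (simp add: abs_le_iff)
  then have "\<bar>c' y * (t - 2 * c y * m\<^sup>2) * (u y)\<^sup>2\<bar> \<le> D * (Q * m\<^sup>2) * (u y)\<^sup>2"
    unfolding abs_mult using c'_bound[OF y] D_nonneg by (auto intro!: mult_mono)
  also have "\<dots> = energy_rate * (lo * \<epsilon> * m\<^sup>2 * (u y)\<^sup>2)"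
    unfolding energy_rate_def using lo_pos \<epsilon>_pos by simp
  also have "\<dots> \<le> energy_rate * energy y"
    by (intro mult_left_mono energy_ge_mass[OF y] energy_rate_nonneg)
  finally show ?thesis .
qed

lemma energy_comparison:
  assumes "x \<in> {0<..<H}" "y \<in> {0<..<H}"
  shows "energy y \<le> exp (energy_rate * H) * energy x"
proof -
  have "energy y \<le> exp (energy_rate * \<bar>y - x\<bar>) * energy x"
    by (rule exponential_comparison[OF energy_deriv energy_deriv_bound assms])
  also have "\<dots> \<le> exp (energy_rate * H) * energy x"
    using assms energy_nonneg[OF assms(1)] energy_rate_nonneg
    by (intro mult_right_mono) (auto intro!: mult_left_mono)
  finally show ?thesis .
qed

lemma mass_integrable:
  assumes "{a..b} \<subseteq> {0..H}"
  shows "set_integrable lborel {a..b} (\<lambda>y. (u y)\<^sup>2)"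
  using assms by (intro borel_integrable_atLeastAtMost' continuous_intros
      continuous_on_subset[OF u_cont])

lemma energy_lower_bound:
  assumes x: "x \<in> {0<..<H}"
  shows "energy_floor * m\<^sup>2 \<le> energy x"
proof -
  let ?M = "exp (energy_rate * H) * energy x / (lo * \<epsilon> * m\<^sup>2)"
  have pos: "0 < lo * \<epsilon> * m\<^sup>2" using lo_pos \<epsilon>_pos m_pos by simp
  have pointwise: "(u y)\<^sup>2 \<le> ?M" if "y \<in> {0<..<H}" for y
    using order_trans[OF energy_ge_mass[OF that] energy_comparison[OF x that]] pos
    by (simp add: pos_le_divide_eq mult.commute)
  have "1 = (LINT y:{0<..<H}|lborel. (u y)\<^sup>2)"
    using u_norm by simp
  also have "\<dots> \<le> (LINT y:{0<..<H}|lborel. ?M)"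
  proof (rule set_integral_mono)
    show "set_integrable lborel {0<..<H} (\<lambda>y. (u y)\<^sup>2)"
      by (rule set_integrable_subset[OF mass_integrable[of 0 H]]) auto
    show "set_integrable lborel {0<..<H} (\<lambda>y. ?M)"
      by (rule set_integrable_subset[of lborel "{0..H}"])
        (auto intro!: borel_integrable_atLeastAtMost' continuous_intros)
  qed (use pointwise in auto)
  also have "\<dots> = H * ?M"
    using H_pos by (subst set_integral_const) auto
  finally show ?thesis
    unfolding energy_floor_def using pos H_pos
    by (simp add: field_simps)
qed

text \<open>With \<open>\<psi>\<close> a cutoff, differentiating \<open>\<psi>\<^sup>2 u p\<close> gives \<open>\<psi>\<^sup>2 (p\<^sup>2 / c - q u\<^sup>2)\<close> plus a cross term
  in \<open>u p\<close>. Completing the square absorbs the cross term into half of \<open>\<psi>\<^sup>2 p\<^sup>2 / c\<close>, and what is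
  left is written by means of the energy.\<close>

lemma localized_virial_identity:
  assumes y: "y \<in> {0<..<H}"
    and \<psi>: "(\<psi> has_real_derivative \<psi>') (at y)"
  shows "((\<lambda>y. (\<psi> y)\<^sup>2 * (u y * p y)) has_real_derivative
            (\<psi> y * p y + 2 * c y * \<psi>' * u y)\<^sup>2 / (2 * c y)
            + (\<psi> y)\<^sup>2 * energy y / (2 * c y)
            - (2 * c y * \<psi>'\<^sup>2 + 3/2 * (\<psi> y)\<^sup>2 * (t - c y * m\<^sup>2)) * (u y)\<^sup>2) (at y)"
proof -
  have "c y \<noteq> 0" using c_pos[OF y] by simp
  then show ?thesis
    unfolding energy_def
    by (auto intro!: derivative_eq_intros \<psi> u_deriv[OF y] p_deriv[OF y]
        simp: field_simps power2_eq_square)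
qed

text \<open>The cutoff is \<open>\<psi>(y) = (y - a)(b - y)\<close>, for which \<open>\<psi> \<le> (b - a)\<^sup>2\<close>, \<open>\<bar>\<psi>'\<bar> \<le> b - a\<close>, and
  the integral of \<open>\<psi>\<^sup>2\<close> over \<open>[a,b]\<close> is \<open>(b - a)\<^sup>5 / 30\<close>. The lower bound \<open>m\<^sub>0\<close> on \<open>m\<close> turns the
  bounded cost of the cutoff into a multiple of \<open>m\<^sup>2\<close>.\<close>

lemma local_mass_lower_bound:
  assumes ab: "a < b" "{a..b} \<subseteq> {0<..<H}" and m0: "0 < m0" "m0 \<le> m"
  shows "energy_floor * (b - a)^5 /
           (60 * hi * (3/2 * (b - a)^4 * Q + 2 * (b - a)\<^sup>2 * hi / m0\<^sup>2))
         \<le> (LINT y:{a..b}|lborel. (u y)\<^sup>2)"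
proof -
  define L where "L = b - a"
  define \<kappa> where "\<kappa> = energy_floor * m\<^sup>2 / (2 * hi)"
  define C where "C = 3/2 * L^4 * Q + 2 * L\<^sup>2 * hi / m0\<^sup>2"
  define \<psi> where "\<psi> = (\<lambda>y. (y - a) * (b - y))"
  define P where "P = (\<lambda>y. L\<^sup>2 * (y - a)^3 / 3 - L * (y - a)^4 / 2 + (y - a)^5 / 5)"
  define G where "G = (\<lambda>y. (\<psi> y)\<^sup>2 * (u y * p y) - \<kappa> * P y)"
  define G' where "G' = (\<lambda>y. (\<psi> y * p y + 2 * c y * (a + b - 2 * y) * u y)\<^sup>2 / (2 * c y)
            + (\<psi> y)\<^sup>2 * energy y / (2 * c y)
            - (2 * c y * (a + b - 2 * y)\<^sup>2 + 3/2 * (\<psi> y)\<^sup>2 * (t - c y * m\<^sup>2)) * (u y)\<^sup>2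
            - \<kappa> * (\<psi> y)\<^sup>2)"
  have L: "0 < L" using ab by (simp add: L_def)
  have Q: "0 < Q" using hi_pos hi_le_Q by simp
  have C: "0 < C" unfolding C_def using L Q hi_pos m0 by (intro add_pos_pos) auto
  have m: "0 < m\<^sup>2" using m_pos by simp
  have \<kappa>: "0 \<le> \<kappa>" unfolding \<kappa>_def using energy_floor_pos hi_pos by simp

  have "(G has_real_derivative G' y) (at y)" if "y \<in> {a..b}" for y
  proof -
    have y: "y \<in> {0<..<H}" using that ab by blast
    have \<psi>d: "(\<psi> has_real_derivative a + b - 2 * y) (at y)"
      unfolding \<psi>_def by (auto intro!: derivative_eq_intros)
    have Pd: "(P has_real_derivative (\<psi> y)\<^sup>2) (at y)"
      unfolding P_def \<psi>_def L_def
      by (auto intro!: derivative_eq_intros simp: field_simps power2_eq_square eval_nat_numeral)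
    show ?thesis
      unfolding G_def G'_def
      by (rule DERIV_diff[OF localized_virial_identity[OF y \<psi>d] DERIV_cmult[OF Pd]])
  qed
  then have "(G' has_integral G b - G a) {a..b}"
    using ab by (intro fundamental_theorem_of_calculus)
      (auto simp flip: has_real_derivative_iff_has_vector_derivative
            intro: has_field_derivative_at_within)
  moreover have "G b - G a = - (\<kappa> * L^5 / 30)"
    unfolding G_def P_def \<psi>_def by (simp add: L_def[symmetric] field_simps eval_nat_numeral)
  ultimately have int_G': "(G' has_integral - (\<kappa> * L^5 / 30)) {a..b}" by simp

  have G'_lower: "- (C * m\<^sup>2) * (u y)\<^sup>2 \<le> G' y" if ab_y: "y \<in> {a..b}" for y
  proof -
    have y: "y \<in> {0<..<H}" using ab_y ab by blast
    have "\<bar>\<psi> y\<bar> \<le> L * L"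
      unfolding \<psi>_def L_def abs_mult using ab_y by (intro mult_mono) auto
    then have "\<bar>\<psi> y\<bar>\<^sup>2 \<le> (L * L)\<^sup>2" by (rule power_mono) simp
    then have \<psi>2: "(\<psi> y)\<^sup>2 \<le> L^4" by (simp add: power2_eq_square eval_nat_numeral mult.assoc)
    have "\<bar>a + b - 2 * y\<bar> \<le> L" using ab_y by (auto simp: L_def abs_le_iff)
    then have "\<bar>a + b - 2 * y\<bar>\<^sup>2 \<le> L\<^sup>2" by (rule power_mono) simp
    then have \<psi>'2: "(a + b - 2 * y)\<^sup>2 \<le> L\<^sup>2" by simp
    have energy_part: "\<kappa> * (\<psi> y)\<^sup>2 \<le> (\<psi> y)\<^sup>2 * energy y / (2 * c y)"
    proof -
      have "\<kappa> \<le> energy y / (2 * c y)"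
        unfolding \<kappa>_def using energy_lower_bound[OF y] c_upper[OF y] c_pos[OF y] energy_nonneg[OF y]
        by (intro frac_le) auto
      then have "(\<psi> y)\<^sup>2 * \<kappa> \<le> (\<psi> y)\<^sup>2 * (energy y / (2 * c y))"
        by (intro mult_left_mono) auto
      then show ?thesis by (simp add: mult.commute)
    qed
    have "2 * c y * (a + b - 2 * y)\<^sup>2 \<le> 2 * hi * L\<^sup>2"
      using c_upper[OF y] c_pos[OF y] \<psi>'2 hi_pos by (intro mult_mono) auto
    also have "\<dots> = 2 * L\<^sup>2 * hi / m0\<^sup>2 * m0\<^sup>2" using m0 by simp
    also have "\<dots> \<le> 2 * L\<^sup>2 * hi / m0\<^sup>2 * m\<^sup>2"
      using m0 hi_pos by (intro mult_left_mono power_mono) auto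
    finally have cutoff_cost: "2 * c y * (a + b - 2 * y)\<^sup>2 \<le> 2 * L\<^sup>2 * hi / m0\<^sup>2 * m\<^sup>2" .
    have "0 \<le> \<epsilon> * m\<^sup>2" using \<epsilon>_pos by simp
    then have "0 \<le> t - c y * m\<^sup>2" using q_lower[OF y] by linarith
    then have "3/2 * (\<psi> y)\<^sup>2 * (t - c y * m\<^sup>2) \<le> 3/2 * L^4 * (Q * m\<^sup>2)"
      using \<psi>2 q_upper[OF y] by (intro mult_mono) auto
    with cutoff_cost have
      "2 * c y * (a + b - 2 * y)\<^sup>2 + 3/2 * (\<psi> y)\<^sup>2 * (t - c y * m\<^sup>2) \<le> C * m\<^sup>2"
      unfolding C_def by (simp add: distrib_right)
    then have "(2 * c y * (a + b - 2 * y)\<^sup>2 + 3/2 * (\<psi> y)\<^sup>2 * (t - c y * m\<^sup>2)) * (u y)\<^sup>2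
               \<le> C * m\<^sup>2 * (u y)\<^sup>2"
      by (rule mult_right_mono) simp
    moreover have "0 \<le> (\<psi> y * p y + 2 * c y * (a + b - 2 * y) * u y)\<^sup>2 / (2 * c y)"
      using c_pos[OF y] by simp
    ultimately show ?thesis
      unfolding G'_def using energy_part by simp
  qed

  define I where "I = integral {a..b} (\<lambda>y. (u y)\<^sup>2)"
  have int_u: "set_integrable lborel {a..b} (\<lambda>y. (u y)\<^sup>2)"
    by (rule mass_integrable[OF order_trans[OF ab(2)]]) auto
  have "((\<lambda>y. (u y)\<^sup>2) has_integral I) {a..b}"
    unfolding I_def by (intro integrable_integral set_borel_integral_eq_integral(1)[OF int_u])
  then have "((\<lambda>y. - (C * m\<^sup>2) * (u y)\<^sup>2) has_integral - (C * m\<^sup>2) * I) {a..b}"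
    by (rule has_integral_mult_right)
  from has_integral_le[OF this int_G' G'_lower] have "\<kappa> * L^5 / 30 \<le> C * m\<^sup>2 * I"
    by simp
  then have "m\<^sup>2 * (energy_floor * L^5 / (60 * hi)) \<le> m\<^sup>2 * (C * I)"
    unfolding \<kappa>_def by (simp add: algebra_simps)
  then have "energy_floor * L^5 / (60 * hi) \<le> C * I"
    using m by (rule mult_left_le_imp_le)
  then have "energy_floor * L^5 / (60 * hi) / C \<le> I"
    by (subst pos_divide_le_eq[OF C]) (simp only: mult.commute)
  then show ?thesis
    unfolding I_def set_borel_integral_eq_integral(2)[OF int_u] C_def L_def by simp
qed

end

section \<open>The uniform lower bound\<close>

theorem theorem4p2:
  fixes \<Omega> :: "(real ^ 'd) set"
    and H \<epsilon> \<Lambda> :: real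
    and c :: "real \<Rightarrow> real"
    and \<mu> :: "nat \<Rightarrow> real"
    and \<beta> :: "nat \<Rightarrow> nat \<Rightarrow> real"
    and u :: "nat \<Rightarrow> real \<Rightarrow> real \<Rightarrow> real"
  assumes "bounded_smooth_domain \<Omega>"
    and "0 < H"
    and "dirichlet_frequencies \<Omega> \<mu>"
    and "C2_on_Icc 0 H c"
    and "0 < c_min H c"
    and "c_min H c < c_max H c"
    and "SL_enumeration H c \<mu> \<beta>"
    and "0 < \<epsilon>"
    and "\<epsilon> < \<Lambda>"
    and "\<And>k t. k \<ge> 1 \<Longrightarrow> (\<mu> k, t) \<in> freq_set_trunc H c \<mu> \<beta> \<epsilon> \<Lambda> \<Longrightarrow>
           normalized_solution H c (\<mu> k) t (u k t)"
  shows "\<forall>a b. a < b \<and> {a<..<b} \<subseteq> {0<..<H} \<longrightarrow>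
           0 < (INF (k, t)\<in>{(k, t). k \<ge> 1 \<and> (\<mu> k, t) \<in> freq_set_trunc H c \<mu> \<beta> \<epsilon> \<Lambda>}.
                  ereal (LINT y:{a<..<b}|lborel. (u k t y)\<^sup>2))"
proof (intro allI impI)
  fix a b :: real
  assume ab: "a < b \<and> {a<..<b} \<subseteq> {0<..<H}"
  then have a: "0 \<le> a" and b: "b \<le> H" and less: "a < b"
    by (auto simp: greaterThanLessThan_subseteq_greaterThanLessThan)
  obtain c' c'' where c': "\<And>y. y \<in> {0..H} \<Longrightarrow> (c has_real_derivative c' y) (at y within {0..H})"
    and c'': "\<And>y. y \<in> {0..H} \<Longrightarrow> (c' has_real_derivative c'' y) (at y within {0..H})"
    using assms(4) unfolding C2_on_Icc_def by blast
  have "continuous_on {0..H} c'" "continuous_on {0..H} c"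
    using DERIV_continuous_on[OF c''] DERIV_continuous_on[OF c'] by blast+
  then have bdd': "bounded (c' ` {0..H})" and bdd: "bounded (c ` {0..H})"
    by (auto intro!: compact_imp_bounded compact_continuous_image)
  obtain D where "\<forall>z\<in>c' ` {0..H}. \<bar>z\<bar> \<le> D"
    using bdd' unfolding bounded_iff real_norm_def by blast
  then have D: "\<bar>c' y\<bar> \<le> D" if "y \<in> {0..H}" for y
    using that by blast
  have c_lower: "c_min H c \<le> c y" and c_upper: "c y \<le> c_max H c" if "y \<in> {0..H}" for y
    unfolding c_min_def c_max_def
    using that bounded_imp_bdd_below[OF bdd] bounded_imp_bdd_above[OF bdd]
    by (auto intro: cINF_lower cSUP_upper)

  \<comment> \<open>The equation holds only inside \<open>(0,H)\<close>, so the cutoff lives on a compact subinterval of it.\<close>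
  define a' where "a' = (2 * a + b) / 3"
  define b' where "b' = (a + 2 * b) / 3"
  have a'b': "a' < b'" "{a'..b'} \<subseteq> {a<..<b}" "{a'..b'} \<subseteq> {0<..<H}"
    using less a b by (auto simp: a'_def b'_def field_simps)
  define Q where "Q = c_max H c + \<Lambda>"
  define floor where "floor = c_min H c * \<epsilon> / (H * exp (D * Q / (c_min H c * \<epsilon>) * H))"
  define \<delta> where "\<delta> = floor * (b' - a')^5 / (60 * c_max H c *
      (3/2 * (b' - a')^4 * Q + 2 * (b' - a')\<^sup>2 * c_max H c / (\<mu> 1)\<^sup>2))"
  have \<mu>1: "0 < \<mu> 1" using assms(3) unfolding dirichlet_frequencies_def by simp
  have hi: "0 < c_max H c" using assms(5,6) by simp
  then have Q: "0 < Q" using assms(8,9) by (simp add: Q_def)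
  have "0 < \<delta>"
    unfolding \<delta>_def floor_def using assms(2,5,8) hi Q a'b'(1) \<mu>1
    by (intro divide_pos_pos mult_pos_pos add_pos_pos) auto

  have lower: "\<delta> \<le> (LINT y:{a<..<b}|lborel. (u k t y)\<^sup>2)"
    if k: "k \<ge> 1" "(\<mu> k, t) \<in> freq_set_trunc H c \<mu> \<beta> \<epsilon> \<Lambda>" for k t
  proof -
    let ?u = "u k t"
    have t: "(c_max H c + \<epsilon>) * (\<mu> k)\<^sup>2 \<le> t" "t \<le> Q * (\<mu> k)\<^sup>2"
      using k(2) unfolding freq_set_trunc_def freq_set_def Q_def by auto
    have \<mu>k: "0 < \<mu> k" "(\<mu> 1)\<^sup>2 \<le> (\<mu> k)\<^sup>2"
      using k(1) assms(3) unfolding dirichlet_frequencies_def by auto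
    then have \<mu>1k: "\<mu> 1 \<le> \<mu> k" by (auto intro: power2_le_imp_le)
    have sol: "normalized_solution H c (\<mu> k) t ?u" by (rule assms(10)[OF k])
    then obtain v w where vw: "\<And>y. y \<in> {0<..<H} \<Longrightarrow> (?u has_real_derivative v y) (at y)"
      "\<And>y. y \<in> {0<..<H} \<Longrightarrow> ((\<lambda>z. c z * v z) has_real_derivative w y) (at y)"
      "\<And>y. y \<in> {0<..<H} \<Longrightarrow> w y + (t - c y * (\<mu> k)\<^sup>2) * ?u y = 0"
      unfolding normalized_solution_def by blast
    interpret oscillatory_mode H "c_min H c" "c_max H c" D \<epsilon> Q "\<mu> k" t c c' ?u "\<lambda>y. c y * v y"
    proof
      fix y assume y: "y \<in> {0<..<H}"
      then have y': "y \<in> {0..H}" by auto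
      show "(c has_real_derivative c' y) (at y)"
        using c'[OF y'] y by (simp add: at_within_Icc_at)
      have "c y \<noteq> 0" using c_lower[OF y'] assms(5) by simp
      then show "(?u has_real_derivative c y * v y / c y) (at y)"
        using vw(1)[OF y] by simp
      have "w y = - (t - c y * (\<mu> k)\<^sup>2) * ?u y" using vw(3)[OF y] by (simp add: algebra_simps)
      then show "((\<lambda>y. c y * v y) has_real_derivative - (t - c y * (\<mu> k)\<^sup>2) * ?u y) (at y)"
        using vw(2)[OF y] by simp
      have "c y * (\<mu> k)\<^sup>2 \<le> c_max H c * (\<mu> k)\<^sup>2"
        by (intro mult_right_mono c_upper[OF y']) auto
      then show "\<epsilon> * (\<mu> k)\<^sup>2 \<le> t - c y * (\<mu> k)\<^sup>2"
        using t by (simp add: algebra_simps)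
      have "0 \<le> c y * (\<mu> k)\<^sup>2" using c_lower[OF y'] assms(5) by simp
      then show "t - c y * (\<mu> k)\<^sup>2 \<le> Q * (\<mu> k)\<^sup>2" using t by simp
    qed (use assms(2,5,8,9) \<mu>k sol c_lower c_upper D in
        \<open>auto simp: normalized_solution_def Q_def\<close>)
    have "\<delta> \<le> (LINT y:{a'..b'}|lborel. (?u y)\<^sup>2)"
      using local_mass_lower_bound[OF a'b'(1,3) \<mu>1 \<mu>1k]
      unfolding \<delta>_def floor_def energy_floor_def energy_rate_def .
    also have "\<dots> \<le> (LINT y:{a<..<b}|lborel. (?u y)\<^sup>2)"
    proof -
      have "set_integrable lborel {a<..<b} (\<lambda>y. (?u y)\<^sup>2)"
        using a b by (intro set_integrable_subset[OF mass_integrable[of a b]]) auto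
      moreover from this have "set_integrable lborel {a'..b'} (\<lambda>y. (?u y)\<^sup>2)"
        by (rule set_integrable_subset) (use a'b' in auto)
      ultimately show ?thesis
        using a'b'(2) unfolding set_lebesgue_integral_def set_integrable_def
        by (intro integral_mono) (auto split: split_indicator)
    qed
    finally show ?thesis .
  qed
  have "0 < ereal \<delta>" using \<open>0 < \<delta>\<close> by simp
  also have "ereal \<delta> \<le> (INF (k, t)\<in>{(k, t). k \<ge> 1 \<and> (\<mu> k, t) \<in> freq_set_trunc H c \<mu> \<beta> \<epsilon> \<Lambda>}.
                  ereal (LINT y:{a<..<b}|lborel. (u k t y)\<^sup>2))"
    using lower by (intro INF_greatest) auto
  finally show "0 < (INF (k, t)\<in>{(k, t). k \<ge> 1 \<and> (\<mu> k, t) \<in> freq_set_trunc H c \<mu> \<beta> \<epsilon> \<Lambda>}.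
                  ereal (LINT y:{a<..<b}|lborel. (u k t y)\<^sup>2))" .
qed

end
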